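(* Let $G$ be a homogeneous $m$-generic $L$-graph. Then every $A\in O(G)$ is monic.
   Context: A language $L$ for coloured $m$-partite graphs specifies, for each pair of distinct $i,j\in\{0,\dots,m-1\}$, a finite nonempty set of colours $C_{ij}=C_{ji}$. An $L$-graph consists of a vertex set partitioned into parts $V_0,\dots,V_{m-1}$ (no edges inside a part) with a colour $F(x,y)=F(y,x)\in C_{ij}$ for all distinct $i,j$, $x\in V_i$, $y\in V_j$. Substructures are induced subgraphs; embeddings are injective, part-preserving, colour-preserving maps. $G$ is homogeneous if every isomorphism between finite induced subgraphs extends to an automorphism. $G$ is $m$-generic if every part is countably infinite and for all distinct $i,j$, every finite $U\subseteq V_i$ and every $f:U\to C_{ij}$ there is $x\in V_j$ with $F(x,u)=f(u)$ for all $u\in U$. A finite $L$-graph is realized in $G$ if it embeds in $G$, otherwise omitted; it is minimally omitted if omitted but all its proper induced subgraphs are realized. $O(G)$ is the class of finite $L$-graphs minimally omitted from $G$. A monic is a finite $L$-graph with at most one vertex in each part. *)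

theory Defs
  imports "HOL-Library.Countable_Set"
begin

record 'c language =
  nparts :: nat
  colours :: "nat \<Rightarrow> nat \<Rightarrow> 'c set"

text \<open>The colour sets are only meaningful for distinct indices below the number of parts.\<close>

definition is_language :: "'c language \<Rightarrow> bool" where
  "is_language L \<longleftrightarrow>
    (\<forall>i < nparts L. \<forall>j < nparts L. i \<noteq> j \<longrightarrow>
      finite (colours L i j) \<and> colours L i j \<noteq> {} \<and> colours L i j = colours L j i)"

text \<open>The partition of the vertex set into indexed, possibly empty, parts is given by
  the function sending a vertex to the index of its part. Values of \<open>part\<close> outside the
  vertex set, and values of \<open>col\<close> on pairs that are not vertices in distinct parts, are
  irrelevant.\<close>

record ('a, 'c) lgraph =
  verts :: "'a set"
  part :: "'a \<Rightarrow> nat"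
  col :: "'a \<Rightarrow> 'a \<Rightarrow> 'c"

definition part_set :: "('a, 'c) lgraph \<Rightarrow> nat \<Rightarrow> 'a set" where
  "part_set G i = {x \<in> verts G. part G x = i}"

definition is_lgraph :: "'c language \<Rightarrow> ('a, 'c) lgraph \<Rightarrow> bool" where
  "is_lgraph L G \<longleftrightarrow>
    (\<forall>x \<in> verts G. part G x < nparts L) \<and>
    (\<forall>x \<in> verts G. \<forall>y \<in> verts G. part G x \<noteq> part G y \<longrightarrow>
      col G x y = col G y x \<and> col G x y \<in> colours L (part G x) (part G y))"

definition finite_lgraph :: "'c language \<Rightarrow> ('a, 'c) lgraph \<Rightarrow> bool" where
  "finite_lgraph L A \<longleftrightarrow> is_lgraph L A \<and> finite (verts A)"

definition induced :: "('a, 'c) lgraph \<Rightarrow> 'a set \<Rightarrow> ('a, 'c) lgraph" where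
  "induced G W = G\<lparr>verts := W\<rparr>"

definition embedding :: "('a, 'c) lgraph \<Rightarrow> ('b, 'c) lgraph \<Rightarrow> ('a \<Rightarrow> 'b) \<Rightarrow> bool" where
  "embedding A G f \<longleftrightarrow>
    f ` verts A \<subseteq> verts G \<and> inj_on f (verts A) \<and>
    (\<forall>x \<in> verts A. part G (f x) = part A x) \<and>
    (\<forall>x \<in> verts A. \<forall>y \<in> verts A. part A x \<noteq> part A y \<longrightarrow> col G (f x) (f y) = col A x y)"

definition isomorphism :: "('a, 'c) lgraph \<Rightarrow> ('b, 'c) lgraph \<Rightarrow> ('a \<Rightarrow> 'b) \<Rightarrow> bool" where
  "isomorphism A B f \<longleftrightarrow> embedding A B f \<and> f ` verts A = verts B"

definition automorphism :: "('a, 'c) lgraph \<Rightarrow> ('a \<Rightarrow> 'a) \<Rightarrow> bool" where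
  "automorphism G g \<longleftrightarrow> isomorphism G G g"

definition homogeneous :: "('a, 'c) lgraph \<Rightarrow> bool" where
  "homogeneous G \<longleftrightarrow>
    (\<forall>U W f. U \<subseteq> verts G \<and> finite U \<and> W \<subseteq> verts G \<and> finite W \<and>
      isomorphism (induced G U) (induced G W) f \<longrightarrow>
      (\<exists>g. automorphism G g \<and> (\<forall>x \<in> U. g x = f x)))"

definition generic :: "'c language \<Rightarrow> ('a, 'c) lgraph \<Rightarrow> bool" where
  "generic L G \<longleftrightarrow>
    (\<forall>i < nparts L. countable (part_set G i) \<and> infinite (part_set G i)) \<and>
    (\<forall>i < nparts L. \<forall>j < nparts L. i \<noteq> j \<longrightarrow>
      (\<forall>U f. U \<subseteq> part_set G i \<and> finite U \<and> (\<forall>u \<in> U. f u \<in> colours L i j) \<longrightarrow>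
        (\<exists>x \<in> part_set G j. \<forall>u \<in> U. col G x u = f u)))"

definition realized :: "('b, 'c) lgraph \<Rightarrow> ('a, 'c) lgraph \<Rightarrow> bool" where
  "realized A G \<longleftrightarrow> (\<exists>f. embedding A G f)"

text \<open>The class $O(G)$. The vertex type of the omitted graphs is independent of that of
  \<open>G\<close>.\<close>

definition minimally_omitted :: "'c language \<Rightarrow> ('a, 'c) lgraph \<Rightarrow> ('b, 'c) lgraph set" where
  "minimally_omitted L G =
    {A. finite_lgraph L A \<and> \<not> realized A G \<and> (\<forall>W. W \<subset> verts A \<longrightarrow> realized (induced A W) G)}"

definition monic :: "'c language \<Rightarrow> ('a, 'c) lgraph \<Rightarrow> bool" where
  "monic L A \<longleftrightarrow> finite_lgraph L A \<and> (\<forall>i < nparts L. card (part_set A i) \<le> 1)"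

end

theory Submission
  imports Defs
begin

text \<open>The key point is that \<open>G\<close> has no algebraicity: the colours of a vertex over a finite set are
  shared by infinitely many vertices of the same part. Granted this, if \<open>a \<noteq> a'\<close> lie in the same part
  of \<open>A\<close>, homogeneity amalgamates copies of \<open>A - {a}\<close> and \<open>A - {a'}\<close> over \<open>A - {a, a'}\<close>, and the image
  of \<open>a\<close> can be moved off that of \<open>a'\<close>, as no colour between the two has to be respected.

  The absence of algebraicity is proved by induction on the size of the finite set \<open>U\<close>. If \<open>U\<close> lies in
  a single part this is genericity. Otherwise take \<open>x, z \<in> U\<close> in different parts; the vertices with the
  same colours over \<open>U - {x, z}\<close> as \<open>b\<close>, \<open>x\<close> or \<open>z\<close> form a homogeneous tripartite graph. If only
  finitely many \<open>b'\<close> complete the edge \<open>xz\<close> to a triangle coloured like \<open>bxz\<close>, then for fixed \<open>z\<close> these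
  triangles form a perfect matching, whence vertices \<open>x\<^sub>1, x\<^sub>2\<close> matched with \<open>b\<^sub>1, b\<^sub>2\<close> have the
  same colour to every vertex of the part of \<open>b\<close> other than \<open>b\<^sub>1\<close> and \<open>b\<^sub>2\<close>. As all
  triples in the part of \<open>x\<close> look alike, this contradicts \<open>b\<close> having two neighbours coloured like \<open>x\<close>.\<close>

section \<open>Finite partial isomorphisms and their extensions\<close>

lemma homogeneous_extend:
  assumes "homogeneous G" "finite U" "U \<subseteq> verts G" "f ` U \<subseteq> verts G" "inj_on f U"
    and "\<And>u. u \<in> U \<Longrightarrow> part G (f u) = part G u"
    and "\<And>u v. u \<in> U \<Longrightarrow> v \<in> U \<Longrightarrow> part G u \<noteq> part G v \<Longrightarrow> col G (f u) (f v) = col G u v"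
  obtains g where "automorphism G g" "\<And>u. u \<in> U \<Longrightarrow> g u = f u"
proof -
  have "isomorphism (induced G U) (induced G (f ` U)) f"
    using assms by (auto simp: isomorphism_def embedding_def induced_def)
  then have "\<exists>g. automorphism G g \<and> (\<forall>x\<in>U. g x = f x)"
    using assms(1-4) unfolding homogeneous_def by blast
  then show ?thesis using that by blast
qed

lemma automorphismD:
  assumes "automorphism G g"
  shows "g ` verts G = verts G" "inj_on g (verts G)"
    and "\<And>x. x \<in> verts G \<Longrightarrow> g x \<in> verts G"
    and "\<And>x. x \<in> verts G \<Longrightarrow> part G (g x) = part G x"
    and "\<And>x y. x \<in> verts G \<Longrightarrow> y \<in> verts G \<Longrightarrow> part G x \<noteq> part G y
           \<Longrightarrow> col G (g x) (g y) = col G x y"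
  using assms by (auto simp: automorphism_def isomorphism_def embedding_def)

section \<open>Triangles in a homogeneous graph\<close>

text \<open>This drives the induction on the number of constraining vertices: \<open>infP\<close>
  and \<open>infQ\<close> each involve one constraint, the conclusion two. Were the completions
  finite in number, they would form a matching too rigid for homogeneity.\<close>

lemma infinite_triangle_completions:
  assumes hom: "homogeneous T"
    and sym: "\<And>u v. u \<in> verts T \<Longrightarrow> v \<in> verts T \<Longrightarrow> part T u \<noteq> part T v \<Longrightarrow> col T u v = col T v u"
    and b: "b \<in> verts T" and x: "x \<in> verts T" and z: "z \<in> verts T"
    and bx: "part T b \<noteq> part T x" and bz: "part T b \<noteq> part T z" and xz: "part T x \<noteq> part T z"
    and infP: "infinite {p \<in> verts T. part T p = part T b \<and> col T p z = col T b z}"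
    and infQ: "infinite {q \<in> verts T. part T q = part T x \<and> col T b q = col T b x}"
  shows "infinite {p \<in> verts T. part T p = part T b \<and> col T p x = col T b x \<and> col T p z = col T b z}"
proof
  define P where "P = {p \<in> verts T. part T p = part T b}"
  define Q where "Q = {q \<in> verts T. part T q = part T x}"
  define Pz where "Pz = {p \<in> P. col T p z = col T b z}"
  define Qz where "Qz = {q \<in> Q. col T q z = col T x z}"
  \<comment> \<open>\<open>M\<close> links the pairs that form with \<open>z\<close> a triangle
    coloured like \<open>b\<close>, \<open>x\<close>, \<open>z\<close>. The full parts
    \<open>P\<close> and \<open>Q\<close> are kept as well, because the last automorphism of the
    proof does not fix \<open>z\<close>.\<close>
  define M where "M p q \<longleftrightarrow> p \<in> Pz \<and> q \<in> Qz \<and> col T p q = col T b x" for p q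
  define S where "S = {p. M p x}"
  assume "finite {p \<in> verts T. part T p = part T b \<and> col T p x = col T b x \<and> col T p z = col T b z}"
  moreover have "S \<subseteq> {p \<in> verts T. part T p = part T b \<and> col T p x = col T b x \<and> col T p z = col T b z}"
    by (auto simp: S_def M_def Pz_def P_def)
  ultimately have finS: "finite S" by (rule finite_subset[rotated])
  have infPz: "infinite Pz" using infP by (simp add: Pz_def P_def)
  have Mbx: "M b x" using b x by (auto simp: M_def Pz_def P_def Qz_def Q_def)
  have SPz: "S \<subseteq> Pz" by (auto simp: S_def M_def)
  note aut = automorphismD
  have mem: "p \<in> verts T" "part T p = part T b" if "p \<in> P" for p using that by (auto simp: P_def)
  have memQ: "q \<in> verts T" "part T q = part T x" if "q \<in> Q" for q using that by (auto simp: Q_def)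
  have memPz: "p \<in> P" "col T p z = col T b z" "col T z p = col T b z" if "p \<in> Pz" for p
    using that mem[of p] sym[of z p] z bz by (auto simp: Pz_def)
  have memQz: "q \<in> Q" "col T q z = col T x z" "col T z q = col T x z" if "q \<in> Qz" for q
    using that memQ[of q] sym[of z q] z xz by (auto simp: Qz_def)
  have gPQ: "p \<in> P \<Longrightarrow> g p \<in> P" "q \<in> Q \<Longrightarrow> g q \<in> Q"
    "p \<in> P \<Longrightarrow> q \<in> Q \<Longrightarrow> col T (g p) (g q) = col T p q" if "automorphism T g" for g p q
    using aut[OF that] bx by (auto simp: P_def Q_def)
  have gz: "p \<in> Pz \<Longrightarrow> g p \<in> Pz" "q \<in> Qz \<Longrightarrow> g q \<in> Qz"
    if "automorphism T g" "g z = z" for g p q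
  proof -
    show "p \<in> Pz \<Longrightarrow> g p \<in> Pz" 
      using gPQ(1)[OF that(1), of p] aut(5)[OF that(1), of p z] that(2) mem z bz
      by (simp add: Pz_def)
    show "q \<in> Qz \<Longrightarrow> g q \<in> Qz"
      using gPQ(2)[OF that(1), of q] aut(5)[OF that(1), of q z] that(2) memQ z xz
      by (simp add: Qz_def)
  qed
  have gM: "M (g p) (g q)" if "automorphism T g" "g z = z" "M p q" for g p q
    using that gz[OF that(1,2)] gPQ(3)[OF that(1)] by (simp add: M_def Pz_def Qz_def)
  \<comment> \<open>There are no colours inside a part, and all of \<open>Pz\<close> has one colour
    to \<open>z\<close>; so with \<open>z\<close> fixed every finite injection within
    \<open>Pz\<close> is a partial isomorphism. The same holds for \<open>Qz\<close> below.\<close>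
  have extP: "\<exists>g. automorphism T g \<and> g z = z \<and> (\<forall>u\<in>U. g u = f u)"
    if U: "finite U" "U \<subseteq> Pz" "f ` U \<subseteq> Pz" "inj_on f U" for U f
  proof -
    let ?f = "\<lambda>u. if u = z then z else f u"
    have nz: "u \<noteq> z" if "u \<in> Pz" for u using mem memPz(1) that bz by metis
    have fU: "f u \<in> Pz" if "u \<in> U" for u using that U by blast
    have UPz: "u \<in> Pz" if "u \<in> U" for u using that U by blast
    obtain g where "automorphism T g" "\<And>u. u \<in> insert z U \<Longrightarrow> g u = ?f u"
    proof (rule homogeneous_extend[OF hom, of "insert z U" ?f])
      show "inj_on ?f (insert z U)"
        using U(4) nz fU UPz by (auto simp: inj_on_def) 
      show "part T (?f u) = part T u" if "u \<in> insert z U" for u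
        using that mem memPz(1) fU UPz by auto
      show "col T (?f u) (?f v) = col T u v"
        if "u \<in> insert z U" "v \<in> insert z U" "part T u \<noteq> part T v" for u v
        using that mem memPz fU UPz nz by auto
    qed (use U z mem memPz in auto)
    then show ?thesis using nz UPz by (intro exI[of _ g]) auto
  qed
  have extQ: "\<exists>g. automorphism T g \<and> g z = z \<and> (\<forall>u\<in>U. g u = f u)"
    if U: "finite U" "U \<subseteq> Qz" "f ` U \<subseteq> Qz" "inj_on f U" for U f
  proof -
    let ?f = "\<lambda>u. if u = z then z else f u"
    have nz: "u \<noteq> z" if "u \<in> Qz" for u using memQ memQz(1) that xz by metis
    have fU: "f u \<in> Qz" if "u \<in> U" for u using that U by blast
    have UQz: "u \<in> Qz" if "u \<in> U" for u using that U by blast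
    obtain g where "automorphism T g" "\<And>u. u \<in> insert z U \<Longrightarrow> g u = ?f u"
    proof (rule homogeneous_extend[OF hom, of "insert z U" ?f])
      show "inj_on ?f (insert z U)"
        using U(4) nz fU UQz by (auto simp: inj_on_def) 
      show "part T (?f u) = part T u" if "u \<in> insert z U" for u
        using that memQ memQz(1) fU UQz by auto
      show "col T (?f u) (?f v) = col T u v"
        if "u \<in> insert z U" "v \<in> insert z U" "part T u \<noteq> part T v" for u v
        using that memQ memQz fU UQz nz by auto
    qed (use U z memQ memQz in auto)
    then show ?thesis using nz UQz by (intro exI[of _ g]) auto
  qed
  have xQz: "x \<in> Qz" and bPz: "b \<in> Pz" using Mbx by (auto simp: M_def)

  \<comment> \<open>Since \<open>S\<close> is finite and \<open>Pz\<close> is not, \<open>S\<close>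
    can be moved to a set \<open>S'\<close> disjoint from it. This takes \<open>x\<close> to a
    vertex whose neighbours under \<open>M\<close> all lie in \<open>S'\<close>.\<close>
  obtain x' where x': "x' \<in> Qz" "x' \<noteq> x" "\<And>p. M p x \<Longrightarrow> \<not> M p x'"
  proof -
    have "infinite (Pz - S)" using infPz finS by simp
    then obtain S' where S': "S' \<subseteq> Pz - S" "finite S'" "card S' = card S"
      using infinite_arbitrarily_large by metis
    then obtain f where f: "bij_betw f S S'" using finS finite_same_card_bij by metis
    then obtain g where g: "automorphism T g" "g z = z" "\<And>u. u \<in> S \<Longrightarrow> g u = f u"
      using extP[OF finS SPz, of f] S'(1) by (auto simp: bij_betw_def)
    have disj: "\<not> M p (g x)" if "M p x" for p
    proof
      assume p: "M p (g x)"
      then obtain p0 where p0: "p0 \<in> verts T" "p = g p0"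
        using aut(1)[OF g(1)] mem memPz(1) by (metis M_def image_iff)
      have xv: "x \<in> verts T" by fact
      have pp: "part T p0 = part T b"
        using aut(4)[OF g(1) p0(1)] p0(2) p mem memPz(1) by (auto simp: M_def)
      have "col T p0 z = col T b z" 
        using aut(5)[OF g(1) p0(1) z] pp bz g(2) p p0(2) by (auto simp: M_def Pz_def)
      moreover have "col T p0 x = col T b x" 
        using aut(5)[OF g(1) p0(1) xv] pp bx p p0(2) by (auto simp: M_def)
      ultimately have "p0 \<in> S" using p0 pp xQz by (auto simp: S_def M_def Pz_def P_def)
      then have "p \<in> S'" using g(3) p0(2) f by (auto simp: bij_betw_def)
      with \<open>M p x\<close> S'(1) show False by (auto simp: S_def)
    qed
    show ?thesis using that[of "g x"] disj Mbx gM[OF g(1,2) Mbx] gz(2)[OF g(1,2) xQz] by metis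
  qed
  \<comment> \<open>Any two vertices of \<open>Qz\<close> can be carried to \<open>x\<close> and
    \<open>x'\<close>, so the disjointness found for that one pair holds for all pairs.\<close>
  have uniqQ: "q1 = q2" if "M p q1" "M p q2" for p q1 q2
  proof (rule ccontr)
    assume ne: "q1 \<noteq> q2"
    have "q1 \<in> Qz" "q2 \<in> Qz" using that by (auto simp: M_def)
    then obtain g where g: "automorphism T g" "g z = z" "g q1 = x" "g q2 = x'"
      using extQ[of "{q1, q2}" "\<lambda>u. if u = q1 then x else x'"] ne x'(1,2) xQz by auto
    show False using gM[OF g(1,2) that(1)] gM[OF g(1,2) that(2)] g x'(3) by auto
  qed
  \<comment> \<open>Fix one neighbour \<open>r1\<close> of \<open>x\<close> and move another one,
    \<open>r2\<close>, out of \<open>S\<close>. By \<open>uniqQ\<close> the vertex \<open>x\<close>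
    is determined by \<open>r1\<close>, so it stays in place and acquires a neighbour outside
    \<open>S\<close>.\<close>
  have uniqP: "p1 = p2" if "M p1 q" "M p2 q" for p1 p2 q
  proof (rule ccontr)
    assume ne: "p1 \<noteq> p2"
    have "q \<in> Qz" using that by (auto simp: M_def)
    then obtain h where h: "automorphism T h" "h z = z" "h q = x"
      using extQ[of "{q}" "\<lambda>u. x"] xQz by auto
    define r1 r2 where "r1 = h p1" and "r2 = h p2"
    have r: "M r1 x" "M r2 x" "r1 \<noteq> r2"
      using gM[OF h(1,2)] that h(3) ne aut(2)[OF h(1)] mem memPz(1)
      by (auto simp: r1_def r2_def M_def inj_on_def)
    obtain r3 where r3: "r3 \<in> Pz" "r3 \<notin> S" using infPz finS
      by (meson finite_subset subsetI)
    have "r1 \<in> Pz" "r2 \<in> Pz" "r3 \<noteq> r1" using r r3 by (auto simp: M_def S_def)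
    then obtain g where g: "automorphism T g" "g z = z" "g r1 = r1" "g r2 = r3"
      using extP[of "{r1, r2}" "\<lambda>u. if u = r1 then r1 else r3"] r(3) r3(1) by auto
    have "M r1 (g x)" "M r3 (g x)" using gM[OF g(1,2) r(1)] gM[OF g(1,2) r(2)] g(3,4) by auto
    with uniqQ r(1) have "M r3 x" by metis
    with r3 show False by (simp add: S_def)
  qed
  have matched: "\<exists>q. M p q" if "p \<in> Pz" for p
  proof -
    have "\<exists>g. automorphism T g \<and> g z = z \<and> g b = p"
      using extP[of "{b}" "\<lambda>u. p"] that bPz by auto
    then show ?thesis using gM Mbx by metis
  qed
  \<comment> \<open>Move \<open>p1\<close> to \<open>p2\<close> while fixing \<open>z\<close> and
    \<open>p\<close>; the matching forces \<open>q1\<close> to go to \<open>q2\<close>. As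
    \<open>p\<close> and \<open>z\<close> are both fixed, \<open>p\<close> may have any colour to
    \<open>z\<close>, which matters for \<open>b0\<close> below.\<close>
  have agree: "col T p q1 = col T p q2"
    if "M p1 q1" "M p2 q2" "p \<in> P" and pne: "p \<noteq> p1" "p \<noteq> p2" for p p1 p2 q1 q2
  proof -
    let ?f = "\<lambda>u. if u = p1 then p2 else u"
    have pv: "p \<in> verts T" "part T p = part T b" using mem that(3) by auto
    have p12: "p1 \<in> Pz" "p2 \<in> Pz" using that by (auto simp: M_def)
    then have pv12: "p1 \<in> verts T" "part T p1 = part T b" "p2 \<in> verts T" "part T p2 = part T b"
      using mem memPz by auto
    have nz: "z \<noteq> p1" "z \<noteq> p2" "z \<noteq> p" using pv pv12 bz by auto
    obtain g where g: "automorphism T g" "\<And>u. u \<in> {z, p1, p} \<Longrightarrow> g u = ?f u"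
    proof (rule homogeneous_extend[OF hom, of "{z, p1, p}" ?f])
      show "inj_on ?f {z, p1, p}" using nz pne by (auto simp: inj_on_def)
      show "part T (?f u) = part T u" if "u \<in> {z, p1, p}" for u using that pv12 by auto
      show "col T (?f u) (?f v) = col T u v"
        if "u \<in> {z, p1, p}" "v \<in> {z, p1, p}" "part T u \<noteq> part T v" for u v
        using that pv pv12 nz memPz[OF p12(1)] memPz[OF p12(2)] by auto
    qed (use pv pv12 z in auto)
    have g': "g z = z" "g p1 = p2" "g p = p" using g(2) nz pne by auto
    have "M p2 (g q1)" using gM[OF g(1) g'(1) that(1)] g'(2) by simp
    then have "g q1 = q2" using uniqQ that(2) by blast
    then show ?thesis using gPQ(3)[OF g(1) that(3), of q1] g'(3) that(1)
      by (auto simp: M_def Qz_def)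
  qed
  have differ: "col T p1 q2 \<noteq> col T b x" if "M p1 q1" "M p2 q2" "p1 \<noteq> p2" for p1 p2 q1 q2
    using that uniqP unfolding M_def by blast

  obtain b2 where b2: "b2 \<in> Pz" "b2 \<noteq> b"
    using infPz by (metis finite.simps insertCI subsetI finite_subset)
  obtain b3 where b3: "b3 \<in> Pz" "b3 \<noteq> b" "b3 \<noteq> b2"
  proof -
    have "infinite (Pz - {b, b2})" using infPz by simp
    then obtain b3 where "b3 \<in> Pz - {b, b2}" by (metis ex_in_conv finite.emptyI)
    then show ?thesis using that by blast
  qed
  obtain x2 x3 where M2: "M b2 x2" and M3: "M b3 x3" using matched b2 b3 by metis
  have xs: "x2 \<noteq> x" "x3 \<noteq> x" "x3 \<noteq> x2" using uniqP Mbx M2 M3 b2 b3 by metis+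
  have "infinite ({q \<in> verts T. part T q = part T x \<and> col T b q = col T b x} - {x})"
    using infQ by simp
  then obtain y where "y \<in> {q \<in> verts T. part T q = part T x \<and> col T b q = col T b x} - {x}"
    by (metis ex_in_conv finite.emptyI)
  then have y: "y \<in> Q" "col T b y = col T b x" "y \<noteq> x" by (auto simp: Q_def)
  have cbx2: "col T b x2 \<noteq> col T b x" using differ[OF Mbx M2] b2 by auto
  with y have yx2: "y \<noteq> x2" by auto
  have xQ: "x \<in> Q" "x2 \<in> Q" "x3 \<in> Q" using Mbx M2 M3 by (simp_all add: M_def Qz_def)
  have xv: "x2 \<in> verts T" "part T x2 = part T x" "x3 \<in> verts T" "part T x3 = part T x"
    "y \<in> verts T" "part T y = part T x"
    using xQ y(1) memQ by blast+
  \<comment> \<open>By \<open>uniqQ\<close> the vertex \<open>y\<close> lies outside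
    \<open>Qz\<close>, so \<open>z\<close> cannot be fixed here. Any injection between triples
    inside one part is a partial isomorphism.\<close>
  let ?f = "\<lambda>u. if u = x then x else if u = x2 then y else x2"
  obtain g where g: "automorphism T g" "\<And>u. u \<in> {x, x2, x3} \<Longrightarrow> g u = ?f u"
  proof (rule homogeneous_extend[OF hom, of "{x, x2, x3}" ?f])
    show "inj_on ?f {x, x2, x3}" using xs y yx2 by (auto simp: inj_on_def)
  qed (use x xv in auto)
  have g': "g x = x" "g x2 = y" "g x3 = x2" using g(2) xs by auto
  \<comment> \<open>The preimage \<open>b0\<close> of \<open>b\<close> has the colour of
    \<open>b\<close>, \<open>x\<close> to both \<open>x\<close> and \<open>x2\<close>, but not to
    \<open>x3\<close>. Its colour to \<open>x\<close> separates it from \<open>b3\<close>, its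
    colour to \<open>x2\<close> from \<open>b\<close>; hence \<open>agree\<close> applies to
    \<open>x\<close> and \<open>x3\<close> and is violated.\<close>
  obtain b0 where b0: "b0 \<in> verts T" "g b0 = b" using aut(1)[OF g(1)] b by (metis image_iff)
  then have b0P: "b0 \<in> P" using aut(4)[OF g(1) b0(1)] by (simp add: P_def)
  have c0: "col T b0 x = col T b x" "col T b0 x2 = col T b x" "col T b0 x3 \<noteq> col T b x"
    using gPQ(3)[OF g(1) b0P] xQ g' b0(2) y(2) cbx2 by metis+
  have "b0 \<noteq> b" using c0(2) cbx2 by auto
  moreover have "b0 \<noteq> b3" using c0(1) differ[OF M3 Mbx] b3 by auto
  ultimately show False using agree[OF Mbx M3 b0P] c0 by auto
qed

section \<open>Types over finite sets\<close>

text \<open>These are the realizations of the quantifier-free type of \<open>t\<close> over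
  \<open>U\<close>, except that vertices of \<open>U\<close> in the part of \<open>t\<close> impose
  nothing, not even being different from them.\<close>

definition same_type :: "('a, 'c) lgraph \<Rightarrow> 'a set \<Rightarrow> 'a \<Rightarrow> 'a set" where
  "same_type G U t =
    {y \<in> verts G. part G y = part G t \<and> (\<forall>u\<in>U. part G u \<noteq> part G t \<longrightarrow> col G y u = col G t u)}"

lemma lgraph_sym:
  "is_lgraph L G \<Longrightarrow> x \<in> verts G \<Longrightarrow> y \<in> verts G \<Longrightarrow> part G x \<noteq> part G y \<Longrightarrow> col G x y = col G y x"
  by (auto simp: is_lgraph_def)

text \<open>A partial isomorphism of the subgraph stays one after adding the identity on
  \<open>W\<close>. An automorphism of \<open>G\<close> extending it fixes \<open>W\<close>
  pointwise, so it preserves types over \<open>W\<close> and maps the subgraph onto itself.\<close>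

lemma homogeneous_same_types:
  assumes G: "is_lgraph L G" "homogeneous G"
    and W: "finite W" "W \<subseteq> verts G"
    and B: "inj_on (part G) B"
  shows "homogeneous (induced G (\<Union>t\<in>B. same_type G W t - W))" (is "homogeneous (induced G ?T)")
  unfolding homogeneous_def
proof (intro allI impI, elim conjE)
  fix U U' f
  assume U: "U \<subseteq> verts (induced G ?T)" "finite U" and U': "U' \<subseteq> verts (induced G ?T)"
    and iso: "isomorphism (induced (induced G ?T) U) (induced (induced G ?T) U') f"
  have UT: "U \<subseteq> ?T" and fU: "f ` U \<subseteq> ?T" and injf: "inj_on f U"
    and pf: "\<And>u. u \<in> U \<Longrightarrow> part G (f u) = part G u"
    and cf: "\<And>u v. u \<in> U \<Longrightarrow> v \<in> U \<Longrightarrow> part G u \<noteq> part G v \<Longrightarrow> col G (f u) (f v) = col G u v"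
    using U U' iso by (auto simp: induced_def isomorphism_def embedding_def)
  have TG: "?T \<subseteq> verts G" "?T \<inter> W = {}" by (auto simp: same_type_def)
  \<comment> \<open>As the members of \<open>B\<close> lie in different parts, the part of a vertex
    tells which type it realizes.\<close>
  have same: "col G y w = col G y' w"
    if "y \<in> ?T" "y' \<in> ?T" "part G y = part G y'" "w \<in> W" "part G w \<noteq> part G y" for y y' w
  proof -
    obtain t t' where t: "t \<in> B" "t' \<in> B" "y \<in> same_type G W t" "y' \<in> same_type G W t'"
      using \<open>y \<in> ?T\<close> \<open>y' \<in> ?T\<close> by blast
    then have "t = t'" using \<open>part G y = part G y'\<close> B by (auto simp: same_type_def inj_on_def)
    then show ?thesis using t that by (auto simp: same_type_def)
  qed
  let ?f = "\<lambda>u. if u \<in> W then u else f u"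
  have fT: "f u \<in> ?T" if "u \<in> U" for u using fU that by blast
  have fW: "f u \<notin> W" "f u \<in> verts G" "u \<notin> W" "u \<in> verts G" if "u \<in> U" for u
    using fT[OF that] TG UT that by blast+
  have sameU: "col G (f u) w = col G u w" "col G w (f u) = col G w u"
    if "u \<in> U" "w \<in> W" "part G w \<noteq> part G u" for u w
  proof -
    show "col G (f u) w = col G u w" using same[of "f u" u w] that fT[of u] pf[of u] UT by (metis subsetD)
    moreover have "w \<in> verts G" using that W by blast
    ultimately show "col G w (f u) = col G w u"
      using lgraph_sym[OF G(1), of "f u" w] lgraph_sym[OF G(1), of u w] fW pf that by auto
  qed
  obtain g where g: "automorphism G g" "\<And>u. u \<in> W \<union> U \<Longrightarrow> g u = ?f u"
  proof (rule homogeneous_extend[OF G(2), of "W \<union> U" ?f])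
    show "inj_on ?f (W \<union> U)" using injf fW by (auto simp: inj_on_def)
    show "part G (?f u) = part G u" if "u \<in> W \<union> U" for u using that pf by auto
    show "col G (?f u) (?f v) = col G u v"
      if "u \<in> W \<union> U" "v \<in> W \<union> U" "part G u \<noteq> part G v" for u v
      using that cf sameU fW by auto
  qed (use W U fW in auto)
  note aut = automorphismD[OF g(1)]
  have gW: "g w = w" if "w \<in> W" for w using g(2)[of w] that by simp
  have colg: "col G (g y) w = col G y w" if "y \<in> verts G" "w \<in> W" "part G w \<noteq> part G y" for y w
    using aut(5)[of y w] gW[OF that(2)] that W by auto
  have notW: "g y \<in> W \<longleftrightarrow> y \<in> W" if "y \<in> verts G" for y
    using aut(2) gW W that by (metis inj_on_def subsetD)
  have iff: "g y \<in> ?T \<longleftrightarrow> y \<in> ?T" if "y \<in> verts G" for y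
    using that aut(3,4)[OF that] notW colg unfolding same_type_def by auto
  have "g ` ?T = ?T"
  proof
    show "g ` ?T \<subseteq> ?T" using iff TG by blast
    show "?T \<subseteq> g ` ?T"
    proof
      fix y assume y: "y \<in> ?T"
      then obtain y0 where "y0 \<in> verts G" "y = g y0" using aut(1) TG by blast
      then show "y \<in> g ` ?T" using y iff by blast
    qed
  qed
  moreover have "inj_on g ?T" using aut(2) TG(1) by (rule inj_on_subset)
  ultimately have "automorphism (induced G ?T) g"
    using aut TG unfolding automorphism_def isomorphism_def embedding_def induced_def
    by (auto simp: subset_eq)
  moreover have "g u = f u" if "u \<in> U" for u using g(2) that fW by auto
  ultimately show "\<exists>g. automorphism (induced G ?T) g \<and> (\<forall>x\<in>U. g x = f x)" by blast
qed

text \<open>A diagonal argument: genericity yields a vertex that agrees with \<open>t\<close> on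
  \<open>U\<close> and differs from each of the supposedly finitely many realizations at a fresh
  vertex.\<close>

lemma infinite_same_type_one_part:
  assumes G: "is_language L" "is_lgraph L G" "generic L G"
    and t: "t \<in> verts G" and U: "finite U" "U \<subseteq> part_set G j" and j: "j \<noteq> part G t" "j < nparts L"
  shows "infinite (same_type G U t)"
proof
  assume fin: "finite (same_type G U t)"
  let ?i = "part G t"
  have i: "?i < nparts L" using G(2) t by (auto simp: is_lgraph_def)
  have inf: "infinite (part_set G ?i)" "infinite (part_set G j)"
    using G(3) i j by (auto simp: generic_def)
  have cols: "col G y u \<in> colours L j ?i" if "y \<in> part_set G ?i" "u \<in> part_set G j" for y u
  proof -
    have yu: "y \<in> verts G" "part G y = ?i" "u \<in> verts G" "part G u = j"
      using that by (auto simp: part_set_def)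
    then have "col G y u \<in> colours L ?i j" using G(2) j unfolding is_lgraph_def by metis
    then show ?thesis using G(1) i j by (metis is_language_def)
  qed
  have tP: "t \<in> part_set G ?i" using t by (simp add: part_set_def)
  \<comment> \<open>With a single colour available, the whole infinite part would realize the
    type.\<close>
  have two: "\<exists>c'\<in>colours L j ?i. c' \<noteq> c" for c
  proof (rule ccontr)
    assume "\<not> ?thesis"
    then have "col G y u = c" if "y \<in> part_set G ?i" "u \<in> part_set G j" for y u
      using cols[OF that] by blast
    then have "part_set G ?i \<subseteq> same_type G U t"
      using U tP by (fastforce simp: same_type_def part_set_def)
    with fin inf show False using finite_subset by blast
  qed
  define other where "other c = (SOME c'. c' \<in> colours L j ?i \<and> c' \<noteq> c)" for c
  have other: "other c \<in> colours L j ?i" "other c \<noteq> c" for c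
    using someI_ex[of "\<lambda>c'. c' \<in> colours L j ?i \<and> c' \<noteq> c"] two[of c] by (auto simp: other_def)
  \<comment> \<open>The bijection \<open>k\<close> assigns to each vertex of \<open>H\<close> the
    realization that is to be avoided there.\<close>
  have "infinite (part_set G j - U)" using inf U by simp
  then obtain H where H: "H \<subseteq> part_set G j - U" "finite H" "card H = card (same_type G U t)"
    using infinite_arbitrarily_large by metis
  then obtain k where k: "bij_betw k H (same_type G U t)" using fin finite_same_card_bij by metis
  define f where "f u = (if u \<in> U then col G t u else other (col G (k u) u))" for u
  have "U \<union> H \<subseteq> part_set G j" "finite (U \<union> H)" using U H by auto
  moreover have "\<forall>u \<in> U \<union> H. f u \<in> colours L j ?i"
    using cols[OF tP] U other by (auto simp: f_def)
  moreover have "\<And>V f. V \<subseteq> part_set G j \<and> finite V \<and> (\<forall>u \<in> V. f u \<in> colours L j ?i)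
      \<Longrightarrow> \<exists>y \<in> part_set G ?i. \<forall>u \<in> V. col G y u = f u"
    using G(3) i j by (simp add: generic_def)
  ultimately have "\<exists>y \<in> part_set G ?i. \<forall>u \<in> U \<union> H. col G y u = f u" by presburger
  then obtain y where y: "y \<in> part_set G ?i" "\<forall>u \<in> U \<union> H. col G y u = f u" by blast
  then have "y \<in> same_type G U t" by (auto simp: same_type_def part_set_def f_def)
  then obtain u where u: "u \<in> H" "k u = y" using k by (metis bij_betw_imp_surj_on imageE)
  then have "u \<notin> U" "u \<in> U \<union> H" using H by auto
  then have "col G y u = other (col G y u)" using y(2) u(2) f_def by metis
  then show False using other by metis
qed

lemma infinite_same_type:
  assumes G: "is_language L" "is_lgraph L G" "homogeneous G" "generic L G"
    and "finite U" "U \<subseteq> verts G" "t \<in> verts G"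
  shows "infinite (same_type G U t)"
  using assms(5-)
proof (induction "card U" arbitrary: U t rule: less_induct)
  case less
  note U = less.prems
  have IH: "infinite (same_type G U' t')"
    if "U' \<subseteq> verts G" "finite U'" "card U' < card U" "t' \<in> verts G" for U' t'
    by (rule less.hyps[OF that(3,2,1,4)])
  consider u where "u \<in> U" "part G u = part G t"
    | u1 u2 where "\<forall>u\<in>U. part G u \<noteq> part G t" "u1 \<in> U" "u2 \<in> U" "part G u1 \<noteq> part G u2"
    | u1 where "\<forall>u\<in>U. part G u = part G u1 \<and> part G u \<noteq> part G t" "u1 \<in> U"
    | "U = {}"
    by blast
  then show ?case
  proof cases
    case 1
    have "same_type G U t = same_type G (U - {u}) t" using 1 by (auto simp: same_type_def)
    moreover have "infinite (same_type G (U - {u}) t)"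
      using U 1 by (intro IH) (auto intro: card_Diff1_less simp del: card_Diff_insert)
    ultimately show ?thesis by simp
  next
    case 2
    \<comment> \<open>The constraints from \<open>W\<close> are absorbed into the choice of
      \<open>T\<close>, which leaves only the two colours to \<open>u1\<close> and \<open>u2\<close>
      to be controlled.\<close>
    define W where "W = U - {u1, u2}"
    define T where "T = (\<Union>s\<in>{t, u1, u2}. same_type G W s - W)"
    have parts: "part G u1 \<noteq> part G t" "part G u2 \<noteq> part G t" "part G u1 \<noteq> part G u2"
      using 2 by auto
    have W: "finite W" "W \<subseteq> verts G" using U by (auto simp: W_def)
    have UW: "U = insert u1 (insert u2 W)" "u1 \<notin> W" "u2 \<notin> W" "u1 \<noteq> u2" using 2 by (auto simp: W_def)
    then have cardU: "card U = Suc (Suc (card W))" using W by simp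
    have tW: "t \<notin> W" using 2 by (auto simp: W_def)
    have uv: "u1 \<in> verts G" "u2 \<in> verts G" using U 2 by auto
    have inT: "t \<in> T" "u1 \<in> T" "u2 \<in> T" using tW UW uv U by (auto simp: T_def same_type_def)
    have TG: "T \<subseteq> verts G" by (auto simp: T_def same_type_def)
    have Tpart: "y \<in> same_type G W s" if "y \<in> T" "s \<in> {t, u1, u2}" "part G y = part G s" for y s
      using that parts by (auto simp: T_def same_type_def)
    have "infinite {p \<in> T. part G p = part G t \<and> col G p u1 = col G t u1 \<and> col G p u2 = col G t u2}"
    proof (rule infinite_triangle_completions[of "induced G T" t u1 u2, unfolded induced_def, simplified])
      show "homogeneous (G\<lparr>verts := T\<rparr>)" unfolding T_def induced_def[symmetric]
        by (rule homogeneous_same_types[OF G(2,3) W]) (use parts in \<open>simp add: inj_on_def\<close>)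
      have "same_type G (insert u2 W) t - W \<subseteq> {p \<in> T. part G p = part G t \<and> col G p u2 = col G t u2}"
        using parts by (auto simp: T_def same_type_def)
      moreover have "infinite (same_type G (insert u2 W) t - W)"
        using IH[of "insert u2 W" t] U W uv cardU UW by simp
      ultimately show "infinite {p \<in> T. part G p = part G t \<and> col G p u2 = col G t u2}"
        by (rule infinite_super)
      \<comment> \<open>Here the roles change: the induction hypothesis is used for
        \<open>u1\<close>, with \<open>t\<close> among the constraints, which is why it has to hold
        for every base vertex.\<close>
      have "same_type G (insert t W) u1 - W \<subseteq> {q \<in> T. part G q = part G u1 \<and> col G q t = col G u1 t}"
        using parts by (auto simp: T_def same_type_def)
      also have "\<dots> \<subseteq> {q \<in> T. part G q = part G u1 \<and> col G t q = col G t u1}"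
        using lgraph_sym[OF G(2)] parts TG U(3) uv by (smt (verit) Collect_mono subsetD)
      finally have "same_type G (insert t W) u1 - W
        \<subseteq> {q \<in> T. part G q = part G u1 \<and> col G t q = col G t u1}" .
      moreover have "infinite (same_type G (insert t W) u1 - W)"
        using IH[of "insert t W" u1] U W uv cardU tW by simp
      ultimately show "infinite {q \<in> T. part G q = part G u1 \<and> col G t q = col G t u1}"
        by (rule infinite_super)
      show "col G u v = col G v u" if "u \<in> T" "v \<in> T" "part G u \<noteq> part G v" for u v
        using lgraph_sym[OF G(2)] that TG by blast
    qed (use inT parts in auto)
    moreover have "{p \<in> T. part G p = part G t \<and> col G p u1 = col G t u1 \<and> col G p u2 = col G t u2}
        \<subseteq> same_type G U t"
    proof
      fix p assume p: "p \<in> {p \<in> T. part G p = part G t \<and> col G p u1 = col G t u1 \<and> col G p u2 = col G t u2}"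
      then have "p \<in> same_type G W t" using Tpart by simp
      then show "p \<in> same_type G U t" using p UW(1) by (simp add: same_type_def)
    qed
    ultimately show ?thesis by (rule infinite_super[rotated])
  next
    case 3
    have "u1 \<in> verts G" using 3 U by blast
    then have "part G u1 < nparts L" using G(2) by (simp add: is_lgraph_def)
    moreover have "U \<subseteq> part_set G (part G u1)" using 3(1) U(2) by (auto simp: part_set_def)
    moreover have "part G u1 \<noteq> part G t" using 3 by blast
    ultimately show ?thesis
      using infinite_same_type_one_part[OF G(1,2,4) U(3,1)] by blast
  next
    case 4
    then have "same_type G U t = part_set G (part G t)" by (auto simp: same_type_def part_set_def)
    moreover have "part G t < nparts L" using G(2) U(3) by (simp add: is_lgraph_def)
    ultimately show ?thesis using G(4) by (simp add: generic_def)
  qed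
qed

section \<open>Amalgamating two copies with a vertex deleted\<close>

theorem theorem2p2:
  fixes L :: "'c language" and G :: "('a, 'c) lgraph"
  assumes "is_language L"
    and "is_lgraph L G"
    and "homogeneous G"
    and "generic L G"
  shows "\<forall>A \<in> (minimally_omitted L G :: ('b, 'c) lgraph set). monic L A"
proof (intro ballI, rule ccontr)
  fix A :: "('b, 'c) lgraph"
  assume A: "A \<in> minimally_omitted L G" and nm: "\<not> monic L A"
  have fA: "finite (verts A)" and LA: "is_lgraph L A" and nr: "\<not> realized A G"
    and sub: "\<And>W. W \<subset> verts A \<Longrightarrow> realized (induced A W) G"
    using A by (auto simp: minimally_omitted_def finite_lgraph_def)
  obtain i where i: "\<not> card (part_set A i) \<le> 1"
    using nm fA LA by (auto simp: monic_def finite_lgraph_def)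
  have "finite (part_set A i)" using fA by (simp add: part_set_def)
  with i obtain a a' where "a \<in> part_set A i" "a' \<in> part_set A i" "a \<noteq> a'"
    by (metis card_le_Suc0_iff_eq One_nat_def)
  then have a: "a \<in> verts A" "a' \<in> verts A" "a \<noteq> a'" "part A a = part A a'"
    by (auto simp: part_set_def)
  let ?X = "verts A - {a, a'}"
  obtain f where f: "embedding (induced A (verts A - {a})) G f"
    using sub[of "verts A - {a}"] a by (auto simp: realized_def)
  obtain h where h: "embedding (induced A (verts A - {a'})) G h"
    using sub[of "verts A - {a'}"] a by (auto simp: realized_def)
  have fD: "f x \<in> verts G" "part G (f x) = part A x" if "x \<in> verts A" "x \<noteq> a" for x
    using f that by (auto simp: embedding_def induced_def)
  have fC: "col G (f x) (f y) = col A x y"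
    if "x \<in> verts A" "x \<noteq> a" "y \<in> verts A" "y \<noteq> a" "part A x \<noteq> part A y" for x y
    using f that by (auto simp: embedding_def induced_def)
  have finj: "inj_on f (verts A - {a})" using f by (auto simp: embedding_def induced_def)
  have hD: "h x \<in> verts G" "part G (h x) = part A x" if "x \<in> verts A" "x \<noteq> a'" for x
    using h that by (auto simp: embedding_def induced_def)
  have hC: "col G (h x) (h y) = col A x y"
    if "x \<in> verts A" "x \<noteq> a'" "y \<in> verts A" "y \<noteq> a'" "part A x \<noteq> part A y" for x y
    using h that by (auto simp: embedding_def induced_def)
  have hinj: "inj_on h (verts A - {a'})" using h by (auto simp: embedding_def induced_def)
  have fX: "inj_on f ?X" and hX: "inj_on h ?X"
    using finj hinj by (auto intro: inj_on_subset)
  \<comment> \<open>\<open>k\<close> transports the copy of \<open>?X\<close> under \<open>f\<close>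
    to the one under \<open>h\<close>; homogeneity extends it to an automorphism
    \<open>g\<close>.\<close>
  define k where "k = h \<circ> inv_into ?X f"
  have kf: "k (f x) = h x" if "x \<in> ?X" for x using that fX by (simp add: k_def)
  obtain g where g: "automorphism G g" "\<And>u. u \<in> f ` ?X \<Longrightarrow> g u = k u"
  proof (rule homogeneous_extend[OF assms(3), of "f ` ?X" k])
    have "inj_on (k \<circ> f) ?X" using hX kf inj_on_cong[of ?X "k \<circ> f" h] by simp
    then show "inj_on k (f ` ?X)" by (rule inj_on_imageI)
    show "part G (k u) = part G u" if u: "u \<in> f ` ?X" for u
    proof -
      obtain x where "x \<in> ?X" "u = f x" using u by blast
      then show ?thesis using kf[of x] fD[of x] hD[of x] by simp
    qed
    show "f ` ?X \<subseteq> verts G" using fD by auto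
    show "k ` f ` ?X \<subseteq> verts G"
    proof (intro image_subsetI)
      fix u assume "u \<in> f ` ?X"
      then obtain x where "x \<in> ?X" "u = f x" by blast
      then show "k u \<in> verts G" using kf[of x] hD[of x] by simp
    qed
    show "col G (k u) (k v) = col G u v"
      if uv: "u \<in> f ` ?X" "v \<in> f ` ?X" "part G u \<noteq> part G v" for u v
    proof -
      obtain x y where "x \<in> ?X" "y \<in> ?X" "u = f x" "v = f y" using uv by blast
      then show ?thesis using uv(3) kf[of x] kf[of y] fD[of x] fD[of y] fC[of x y] hC[of x y] by simp
    qed
  qed (use fA in auto)
  note aut = automorphismD[OF g(1)]
  \<comment> \<open>\<open>e\<close> embeds \<open>A\<close> without \<open>a\<close> and agrees
    with \<open>h\<close> on \<open>?X\<close>, so only an image for \<open>a\<close> is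
    missing.\<close>
  define e where "e = g \<circ> f"
  have eX: "e x = h x" if "x \<in> ?X" for x using that g(2) kf by (simp add: e_def)
  have eD: "e x \<in> verts G" "part G (e x) = part A x" if "x \<in> verts A" "x \<noteq> a" for x
    using fD[OF that] aut(3,4) by (simp_all add: e_def)
  have eC: "col G (e x) (e y) = col A x y"
    if "x \<in> verts A" "x \<noteq> a" "y \<in> verts A" "y \<noteq> a" "part A x \<noteq> part A y" for x y
    using fC[OF that] fD[of x] fD[of y] that aut(5)[of "f x" "f y"] by (simp add: e_def)
  have einj: "inj_on e (verts A - {a})" unfolding e_def
    by (rule comp_inj_on[OF finj]) (rule inj_on_subset[OF aut(2)], use fD in auto)
  \<comment> \<open>The vertex \<open>h a\<close> has the right colours to the image of
    \<open>?X\<close> but may coincide with \<open>e a'\<close>. Infinitely many vertices share its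
    type, so one can be chosen outside the image of \<open>e\<close>; its relation to
    \<open>e a'\<close> is free because \<open>a\<close> and \<open>a'\<close> lie in one
    part.\<close>
  have "infinite (same_type G (e ` ?X) (h a) - e ` (verts A - {a}))"
    using infinite_same_type[OF assms, of "e ` ?X" "h a"] fA eD hD a by auto
  then obtain y where y: "y \<in> same_type G (e ` ?X) (h a)" "y \<notin> e ` (verts A - {a})"
    by (metis DiffE ex_in_conv finite.emptyI)
  have yv: "y \<in> verts G" "part G y = part A a" using y hD a by (auto simp: same_type_def)
  have yC: "col G y (e x) = col A a x" "col G (e x) y = col A x a"
    if "x \<in> verts A" "part A x \<noteq> part A a" for x
  proof -
    have x: "x \<in> ?X" using that a by auto
    then have ex: "e x \<in> e ` ?X" by (rule imageI)
    have "part G (e x) \<noteq> part G (h a)" using x eX[OF x] hD[of a] hD[of x] a that by simp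
    with ex y(1) have "col G y (e x) = col G (h a) (e x)" unfolding same_type_def by blast
    then show "col G y (e x) = col A a x" using x eX[OF x] hC[of a x] a that by simp
    then show "col G (e x) y = col A x a"
      using lgraph_sym[OF assms(2), of "e x" y] lgraph_sym[OF LA, of x a] x eD[of x] yv that a
      by auto
  qed
  have "embedding A G (e(a := y))" unfolding embedding_def
  proof (intro conjI ballI impI)
    show "e(a := y) ` verts A \<subseteq> verts G" using yv eD by auto
    show "inj_on (e(a := y)) (verts A)" using einj y(2) by (auto simp: inj_on_def)
    show "part G ((e(a := y)) x) = part A x" if "x \<in> verts A" for x using that yv eD by auto
    show "col G ((e(a := y)) x) ((e(a := y)) x') = col A x x'"
      if "x \<in> verts A" "x' \<in> verts A" "part A x \<noteq> part A x'" for x x'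
      using that yC eC by auto
  qed
  then show False using nr by (auto simp: realized_def)
qed

end
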